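(* Let $M$ be a $3\times 3$ integer matrix whose characteristic polynomial $\chi(x)=x^3+Ax^2+Bx+C$ satisfies $1\le A\le B<C$, let $v\in\mathbb{Z}^3\setminus\{0\}$, $\mathcal{D}=\{0,v,2v,\ldots,(C-1)v\}$, and assume that the unique nonempty compact set $T\subset\mathbb{R}^3$ with $MT=T+\mathcal{D}$ has positive Lebesgue measure (i.e., $T$ is a $3$-dimensional self-affine tile with collinear digit set). Then $T$ has exactly $14$ neighbors if and only if $A,B,C$ satisfy one of the following conditions: (1) $1\le A<B<C$, $B\ge 2A-1$, and $C\ge 2(B-A)+2$; (2) $1\le A<B<C$, $B<2A-1$, and $C\ge A+B-2$.
   Context: The condition $1\le A\le B<C$ implies that all eigenvalues of $M$ are greater than $1$ in modulus, so $T$ is well defined. $\mathbb{Z}[M,\mathcal{D}]$ is the smallest $M$-invariant lattice containing $\mathcal{D}$, i.e. the subgroup of $\mathbb{Z}^3$ generated by $\mathcal{D}\cup M\mathcal{D}\cup M^2\mathcal{D}$. The set of neighbors of $T$ is $\mathcal{S}=\{\alpha\in\mathbb{Z}[M,\mathcal{D}]\setminus\{0\};\ T\cap(T+\alpha)\neq\emptyset\}$. *)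

theory Defs
  imports "HOL-Analysis.Analysis" "HOL-Computational_Algebra.Computational_Algebra"
begin

definition charpoly :: "'a::comm_ring_1 ^ 'n ^ 'n \<Rightarrow> 'a poly" where
  "charpoly M = det (mat [:0, 1:] - map_matrix (\<lambda>a. [:a:]) M)"

definition real_vec :: "int ^ 'n \<Rightarrow> real ^ 'n" where
  "real_vec x = (\<chi> i. real_of_int (x $ i))"

definition real_mat :: "int ^ 'n ^ 'm \<Rightarrow> real ^ 'n ^ 'm" where
  "real_mat M = map_matrix real_of_int M"

definition collinear_digits :: "int \<Rightarrow> int ^ 'n \<Rightarrow> (int ^ 'n) set" where
  "collinear_digits C v = (\<lambda>k. k *s v) ` {0..C - 1}"

text \<open>The set equation \<open>M T = T + D\<close>. For expanding \<open>M\<close> and finite nonempty \<open>D\<close> it has exactly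
  one nonempty compact solution.\<close>

definition self_affine_set :: "int ^ 'n ^ 'n \<Rightarrow> (int ^ 'n) set \<Rightarrow> (real ^ 'n) set \<Rightarrow> bool" where
  "self_affine_set M D T \<longleftrightarrow>
     T \<noteq> {} \<and> compact T \<and> (\<lambda>x. real_mat M *v x) ` T = {x + real_vec d | x d. x \<in> T \<and> d \<in> D}"

text \<open>The subgroup of \<open>\<int>\<^sup>3\<close> generated by \<open>D \<union> M D \<union> M\<^sup>2 D\<close>. In dimension 3 it is the smallest
  \<open>M\<close>-invariant subgroup containing \<open>D\<close>, by Cayley--Hamilton.\<close>

definition digit_lattice :: "int ^ 3 ^ 3 \<Rightarrow> (int ^ 3) set \<Rightarrow> (int ^ 3) set" where
  "digit_lattice M D =
     group_closure (D \<union> (\<lambda>d. M *v d) ` D \<union> (\<lambda>d. M *v (M *v d)) ` D)"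

definition neighbors :: "int ^ 3 ^ 3 \<Rightarrow> (int ^ 3) set \<Rightarrow> (real ^ 3) set \<Rightarrow> (int ^ 3) set" where
  "neighbors M D T =
     {\<alpha> \<in> digit_lattice M D - {0}. T \<inter> (\<lambda>x. x + real_vec \<alpha>) ` T \<noteq> {}}"

end

theory Submission
  imports Defs
begin

text \<open>Because \<open>M T = T + D\<close>, every point of \<open>T\<close> has an orbit \<open>x \<mapsto> M x - k v\<close> inside \<open>T\<close>, with digits
\<open>0 \<le> k < C\<close>, and by compactness every digit sequence is realised by such an orbit. The difference of
two orbits in \<open>T\<close> and \<open>T + \<alpha>\<close> is a bounded walk \<open>\<alpha> \<mapsto> M \<alpha> + b v\<close> with \<open>\<bar>b\<bar> < C\<close>. Conversely, for a
bounded walk starting in \<open>\<alpha>\<close>, choose orbits in \<open>T\<close> whose digit differences are the numbers \<open>b\<close>: their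
difference minus the walk is a bounded orbit of \<open>M\<close>, and such an orbit vanishes since \<open>M\<close> is
expanding. So the neighbors are the nonzero lattice points that start a bounded walk.

As \<open>T\<close> has positive measure, it lies in no plane, which makes \<open>v\<close> a cyclic vector of \<open>M\<close>. In
suitable coordinates on the lattice the walk is the shift of an integer sequence \<open>a\<close> with
\<open>\<bar>C a\<^sub>n + B a\<^sub>n\<^sub>+\<^sub>1 + A a\<^sub>n\<^sub>+\<^sub>2 + a\<^sub>n\<^sub>+\<^sub>3\<bar> < C\<close>. The decisive move is to write \<open>a\<^sub>n = u\<^sub>n - u\<^sub>n\<^sub>+\<^sub>1\<close>. The inequality turns
into
  \<open>\<bar>C u\<^sub>n - ((C - B) u\<^sub>n\<^sub>+\<^sub>1 + (B - A) u\<^sub>n\<^sub>+\<^sub>2 + (A - 1) u\<^sub>n\<^sub>+\<^sub>3 + u\<^sub>n\<^sub>+\<^sub>4)\<bar> < C\<close>,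
whose four weights are nonnegative with sum \<open>C\<close>: each \<open>u\<^sub>n\<close> differs by less than 1 from a weighted mean
of the next four terms. Being an integer, it lies between their minimum and their maximum. Hence the
window \<open>u\<^sub>n, \<dots>, u\<^sub>n\<^sub>+\<^sub>3\<close> never gets narrower as \<open>n\<close> grows, and its extremes are eventually constant.

A nonconstant 0-1 word of length 4, continued with period 4, always satisfies the inequality. These
\<open>2\<^sup>4 - 2 = 14\<close> words give 14 distinct neighbors whenever \<open>1 \<le> A \<le> B < C\<close>. There are no others iff no
sequence has a window of width at least 2. If there is such a window, mark its eventual maximum by 1,
its eventual minimum by -1 and everything in between by 0. The signs that arise form a balanced sign
sequence. A short case analysis excludes it if \<open>A < B\<close>, \<open>B - A < (C - B) + (A - 1)\<close> and either
\<open>A - 1 \<le> B - A\<close> or \<open>A - 1 \<le> (C - B) + 1\<close> (lemma \<open>not_balanced\<close>), and this is the condition of the theorem. If it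
fails, one of the periodic sequences \<open>0,1,2,1\<close> or \<open>0,2\<close> or \<open>0,1,2\<close> yields a fifteenth
neighbor (lemma \<open>nonbinary_admissible\<close>).\<close>

section \<open>The characteristic polynomial of a three-dimensional matrix\<close>

lemma charpoly_3:
  fixes M :: "'a::comm_ring_1 ^ 3 ^ 3"
  defines "m \<equiv> \<lambda>i j. vec_nth (vec_nth M i) j"
  shows "charpoly M = [: - det M,
     m 1 1 * m 2 2 - m 1 2 * m 2 1 + m 1 1 * m 3 3 - m 1 3 * m 3 1 + m 2 2 * m 3 3 - m 2 3 * m 3 2,
     - (m 1 1 + m 2 2 + m 3 3), 1:]"
  unfolding charpoly_def det_3
  by (simp add: mat_def map_matrix_def m_def algebra_simps)

lemma charpoly_real_mat:
  fixes M :: "int ^ 3 ^ 3"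
  assumes "charpoly M = [:C, B, A, 1:]"
  shows "charpoly (real_mat M) = [:real_of_int C, real_of_int B, real_of_int A, 1:]"
  using assms unfolding charpoly_3 det_3 by (auto simp: real_mat_def map_matrix_def)

lemma cayley_hamilton_3:
  fixes M :: "'a::comm_ring_1 ^ 3 ^ 3"
  assumes "charpoly M = [:C, B, A, 1:]"
  shows "M *v (M *v (M *v x)) + A *s (M *v (M *v x)) + B *s (M *v x) + C *s x = 0"
proof -
  define m where "m = (\<lambda>i j. vec_nth (vec_nth M i) j)"
  have C: "C = - det M" 
    and B: "B = m 1 1 * m 2 2 - m 1 2 * m 2 1 + m 1 1 * m 3 3 - m 1 3 * m 3 1 + m 2 2 * m 3 3 - m 2 3 * m 3 2"
    and A: "A = - (m 1 1 + m 2 2 + m 3 3)"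
    using assms unfolding charpoly_3 m_def by simp_all
  show ?thesis
    unfolding A B C det_3 m_def
    by (simp add: vec_eq_iff forall_3 matrix_vector_mult_def sum_3 algebra_simps)
qed
section \<open>Sequences that are weighted means of their next four terms\<close>

definition window_max :: "(nat \<Rightarrow> 'a::linorder) \<Rightarrow> nat \<Rightarrow> 'a" where
  "window_max u n = max (max (u n) (u (n+1))) (max (u (n+2)) (u (n+3)))"

definition window_min :: "(nat \<Rightarrow> 'a::linorder) \<Rightarrow> nat \<Rightarrow> 'a" where
  "window_min u n = min (min (u n) (u (n+1))) (min (u (n+2)) (u (n+3)))"

lemma window_bounds:
  assumes "k < 4"
  shows "window_min u n \<le> u (n + k)" "u (n + k) \<le> window_max u n"
proof -
  have "k = 0 \<or> k = 1 \<or> k = 2 \<or> k = 3" using assms by auto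
  then show "window_min u n \<le> u (n + k)" "u (n + k) \<le> window_max u n"
    by (auto simp: window_max_def window_min_def min_le_iff_disj le_max_iff_disj)
qed

lemma window_extremes_attained:
  "\<exists>k<4. u (n + k) = window_max u n" "\<exists>k<4. u (n + k) = window_min u n"
  by (simp_all add: numeral_eq_Suc Ex_less_Suc window_max_def window_min_def max_def min_def)

lemma window_bounds4:
  "window_min u n \<le> u n" "window_min u n \<le> u (n+1)" "window_min u n \<le> u (n+2)" "window_min u n \<le> u (n+3)"
  "u n \<le> window_max u n" "u (n+1) \<le> window_max u n" "u (n+2) \<le> window_max u n" "u (n+3) \<le> window_max u n"
  using window_bounds[of 0 u n] window_bounds[of 1 u n] window_bounds[of 2 u n] window_bounds[of 3 u n] by simp_all

lemma window_extremes_le: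
  "u n \<le> h \<Longrightarrow> u (n+1) \<le> h \<Longrightarrow> u (n+2) \<le> h \<Longrightarrow> u (n+3) \<le> h \<Longrightarrow> window_max u n \<le> h"
  "l \<le> u n \<Longrightarrow> l \<le> u (n+1) \<Longrightarrow> l \<le> u (n+2) \<Longrightarrow> l \<le> u (n+3) \<Longrightarrow> l \<le> window_min u n"
  by (auto simp: window_max_def window_min_def)

lemma window_width_le:
  fixes u :: "nat \<Rightarrow> 'a::linordered_idom"
  assumes "\<And>n. \<bar>u n - u (Suc n)\<bar> \<le> K"
  shows "window_max u n - window_min u n \<le> 3 * K"
proof -
  have "u n - u (n+1) \<le> K" "u (n+1) - u n \<le> K" "u (n+1) - u (n+2) \<le> K" "u (n+2) - u (n+1) \<le> K"
    "u (n+2) - u (n+3) \<le> K" "u (n+3) - u (n+2) \<le> K" 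
    using assms[of n] assms[of "n+1"] assms[of "n+2"] by (simp_all add: abs_le_iff numeral_eq_Suc)
  then have "window_max u n \<le> 3 * K + window_min u n"
    unfolding window_max_def window_min_def max_def min_def by simp
  then show ?thesis by simp
qed

text \<open>This says that all roots of \<open>x\<^sup>3 + A x\<^sup>2 + B x + C\<close> have modulus greater than 1, in the form in which
it is used. The negated partial sums \<open>u\<close> of a solution are exact weighted means of their next four terms, with
weight \<open>q > 0\<close> on the first. Going back four steps therefore moves all of a window towards
one common value and multiplies its width by at most \<open>1 - q\<^sup>4\<close>. As widths are bounded, they are 0.\<close>

lemma bounded_recurrence_eq_0:
  fixes s :: "nat \<Rightarrow> real" and A B C :: real
  assumes ABC: "1 \<le> A" "A \<le> B" "B < C"
    and bounded: "\<And>n. \<bar>s n\<bar> \<le> K"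
    and rec: "\<And>n. s (n+3) + A * s (n+2) + B * s (n+1) + C * s n = 0"
  shows "s n = 0"
proof -
  define u where "u n = - (\<Sum>k<n. s k)" for n
  have s: "s n = u n - u (Suc n)" for n
    by (simp add: u_def)
  define q where "q = (C - B) / C"
  have q: "0 < q" "q \<le> 1" and C: "0 < C"
    using ABC by (auto simp: q_def)
  have avg: "C * u n = (C - B) * u (n+1) + (B - A) * u (n+2) + (A - 1) * u (n+3) + u (n+4)" for n
    using rec[of n] unfolding s by (simp add: algebra_simps numeral_eq_Suc)
  have le: "q * (h - u (n+1)) \<le> h - u n"
    if "u (n+2) \<le> h" "u (n+3) \<le> h" "u (n+4) \<le> h" for n h
  proof -
    have "C * u n \<le> (C - B) * u (n+1) + (B - A) * h + (A - 1) * h + h"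
      unfolding avg using that ABC by (intro add_mono mult_left_mono) auto
    then have "(C - B) * (h - u (n+1)) \<le> (h - u n) * C"
      by (simp add: algebra_simps)
    then show ?thesis
      using C by (simp add: q_def field_simps)
  qed
  have ge: "q * (u (n+1) - l) \<le> u n - l"
    if "l \<le> u (n+2)" "l \<le> u (n+3)" "l \<le> u (n+4)" for n l
  proof -
    have "(C - B) * u (n+1) + (B - A) * l + (A - 1) * l + l \<le> C * u n"
      unfolding avg using that ABC by (intro add_mono mult_left_mono) auto
    then have "(C - B) * (u (n+1) - l) \<le> (u n - l) * C"
      by (simp add: algebra_simps)
    then show ?thesis
      using C by (simp add: q_def field_simps)
  qed
  define width where "width n = window_max u n - window_min u n" for n
  have contract: "width n \<le> (1 - q^4) * width (n+4)" for n
  proof -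
    define h l where "h = window_max u (n+4)" and "l = window_min u (n+4)"
    note wb = window_bounds4[of u "n+4", folded h_def l_def, unfolded add.assoc, simplified]
    \<comment> \<open>In each of the four steps the distance to an extreme of the later window keeps at least the
      fraction \<open>q\<close> of the preceding one, so all four distances are at least \<open>q\<^sup>4 t\<close>.\<close>
    have chain: "q ^ 4 * t \<le> x3 \<and> q ^ 4 * t \<le> x2 \<and> q ^ 4 * t \<le> x1 \<and> q ^ 4 * t \<le> x0"
      if "0 \<le> t" "q * t \<le> x3" "q * x3 \<le> x2" "q * x2 \<le> x1" "q * x1 \<le> x0" for t x3 x2 x1 x0
    proof -
      have 2: "q ^ 2 * t \<le> x2"
        using order_trans[OF mult_left_mono[OF that(2), of q] that(3)] q by (simp add: power2_eq_square mult.assoc)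
      have 3: "q ^ 3 * t \<le> x1"
        using order_trans[OF mult_left_mono[OF 2, of q] that(4)] q by (simp add: power_numeral_reduce mult.assoc)
      have 4: "q ^ 4 * t \<le> x0"
        using order_trans[OF mult_left_mono[OF 3, of q] that(5)] q by (simp add: power_numeral_reduce mult.assoc)
      have "q ^ 4 * t \<le> q ^ 1 * t" "q ^ 4 * t \<le> q ^ 2 * t" "q ^ 4 * t \<le> q ^ 3 * t"
        using q that(1) by (intro mult_right_mono power_decreasing; simp)+
      then show ?thesis
        using 2 3 4 that(2) by simp
    qed
    have pos: "0 \<le> x" if "q * y \<le> x" "0 \<le> y" for x y
      using that q by (meson mult_nonneg_nonneg less_imp_le order_trans)
    have h3: "q * (h - u (n+4)) \<le> h - u (n+3)"
      using le[of "n+3" h] wb by (simp add: numeral_eq_Suc)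
    then have "u (n+3) \<le> h" using pos wb by fastforce
    then have h2: "q * (h - u (n+3)) \<le> h - u (n+2)" "u (n+3) \<le> h"
      using le[of "n+2" h] wb by (simp_all add: numeral_eq_Suc)
    then have "u (n+2) \<le> h" using pos by fastforce
    then have h1: "q * (h - u (n+2)) \<le> h - u (n+1)" "u (n+2) \<le> h"
      using le[of "n+1" h] h2 wb by (simp_all add: numeral_eq_Suc)
    then have "u (n+1) \<le> h" using pos by fastforce
    then have h0: "q * (h - u (n+1)) \<le> h - u n"
      using le[of "n" h] h2 h1 wb by (simp_all add: numeral_eq_Suc)
    have l3: "q * (u (n+4) - l) \<le> u (n+3) - l"
      using ge[of l "n+3"] wb by (simp add: numeral_eq_Suc)
    then have "l \<le> u (n+3)" using pos wb by fastforce
    then have l2: "q * (u (n+3) - l) \<le> u (n+2) - l" "l \<le> u (n+3)"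
      using ge[of l "n+2"] wb by (simp_all add: numeral_eq_Suc)
    then have "l \<le> u (n+2)" using pos by fastforce
    then have l1: "q * (u (n+2) - l) \<le> u (n+1) - l" "l \<le> u (n+2)"
      using ge[of l "n+1"] l2 wb by (simp_all add: numeral_eq_Suc)
    then have "l \<le> u (n+1)" using pos by fastforce
    then have l0: "q * (u (n+1) - l) \<le> u n - l"
      using ge[of l "n"] l2 l1 wb by (simp_all add: numeral_eq_Suc)
    have "window_max u n \<le> h - q ^ 4 * (h - u (n+4))"
      using chain[OF _ h3 h2(1) h1(1) h0] wb by (intro window_extremes_le) auto
    moreover have "l + q ^ 4 * (u (n+4) - l) \<le> window_min u n"
      using chain[OF _ l3 l2(1) l1(1) l0] wb by (intro window_extremes_le) auto
    ultimately show ?thesis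
      unfolding width_def h_def[symmetric] l_def[symmetric] by (simp add: algebra_simps)
  qed
  have bdd: "bdd_above (range width)"
    using window_width_le[of u K] bounded unfolding s width_def by (auto intro!: bdd_aboveI[of _ "3 * K"])
  define D where "D = (SUP n. width n)"
  have le_D: "width n \<le> D" for n
    unfolding D_def using bdd by (intro cSUP_upper) auto
  have "width n \<le> (1 - q ^ 4) * D" for n
  proof -
    have "(1 - q ^ 4) * width (n + 4) \<le> (1 - q ^ 4) * D"
      using q le_D by (intro mult_left_mono) (auto simp: power_le_one)
    then show ?thesis using contract[of n] by simp
  qed
  then have "D \<le> (1 - q ^ 4) * D"
    unfolding D_def by (intro cSUP_least) auto
  then have "q ^ 4 * D \<le> 0" by (simp add: algebra_simps)
  then have "D \<le> 0" using q by (simp add: mult_le_0_iff)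
  then have "width n \<le> 0" using le_D[of n] by simp
  then show ?thesis
    using window_bounds4[of u n] unfolding width_def s by simp
qed

section \<open>Balanced sign sequences\<close>

text \<open>The signs 1 and -1 mark the two extreme values of a sequence in which every window of length four
attains both, and 0 marks the values in between. The inequalities say that after an extreme value
the weighted majority of the signs among the next four terms (with weights \<open>a1, a2, a3, 1\<close>) lies on its side.\<close>

definition balanced :: "int \<Rightarrow> int \<Rightarrow> int \<Rightarrow> (nat \<Rightarrow> int) \<Rightarrow> bool" where
  "balanced a1 a2 a3 c \<longleftrightarrow>
     (\<forall>n. c n \<in> {-1, 0, 1}) \<and>
     (\<forall>n. \<exists>k<4. c (n + k) = 1) \<and> (\<forall>n. \<exists>k<4. c (n + k) = -1) \<and>
     (\<forall>n. c n = 1 \<longrightarrow> 1 \<le> a1 * c (n+1) + a2 * c (n+2) + a3 * c (n+3) + c (n+4)) \<and>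
     (\<forall>n. c n = -1 \<longrightarrow> a1 * c (n+1) + a2 * c (n+2) + a3 * c (n+3) + c (n+4) \<le> -1)"

lemma balanced_uminus:
  assumes "balanced a1 a2 a3 c"
  shows "balanced a1 a2 a3 (\<lambda>n. - c n)"
proof -
  have sign: "- x = 1 \<longleftrightarrow> x = -1" "- x = -1 \<longleftrightarrow> x = 1" "- x \<in> {-1, 0, 1} \<longleftrightarrow> x \<in> {-1, 0, 1}" for x :: int
    by auto
  have "1 \<le> a1 * - c (n+1) + a2 * - c (n+2) + a3 * - c (n+3) + - c (n+4)" if "c n = -1" for n
  proof -
    have "a1 * c (n+1) + a2 * c (n+2) + a3 * c (n+3) + c (n+4) \<le> -1"
      using assms that unfolding balanced_def by blast
    then show ?thesis by simp
  qed
  moreover have "a1 * - c (n+1) + a2 * - c (n+2) + a3 * - c (n+3) + - c (n+4) \<le> -1" if "c n = 1" for n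
  proof -
    have "1 \<le> a1 * c (n+1) + a2 * c (n+2) + a3 * c (n+3) + c (n+4)"
      using assms that unfolding balanced_def by blast
    then show ?thesis by simp
  qed
  ultimately show ?thesis
    using assms unfolding balanced_def sign by blast
qed

context
  fixes a1 a2 a3 :: int
  assumes a1: "1 \<le> a1" and a2: "1 \<le> a2" and a3: "0 \<le> a3"
    and no_alternation: "a2 < a1 + a3" and no_3_cycle: "a3 \<le> a2 \<or> a3 \<le> a1 + 1"
begin

lemma balancedD:
  assumes "balanced a1 a2 a3 c"
  shows "c n \<in> {-1, 0, 1}"
    and "1 \<in> {c n, c (n+1), c (n+2), c (n+3)}" "-1 \<in> {c n, c (n+1), c (n+2), c (n+3)}"
    and "c n = 1 \<Longrightarrow> 1 \<le> a1 * c (n+1) + a2 * c (n+2) + a3 * c (n+3) + c (n+4)"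
    and "c n = -1 \<Longrightarrow> a1 * c (n+1) + a2 * c (n+2) + a3 * c (n+3) + c (n+4) \<le> -1"
proof -
  have k4: "k = 0 \<or> k = 1 \<or> k = 2 \<or> k = 3" if "k < 4" for k :: nat using that by auto
  obtain k where "k < 4" "c (n + k) = 1" using assms unfolding balanced_def by blast
  then show "1 \<in> {c n, c (n+1), c (n+2), c (n+3)}" using k4[of k] by auto
  obtain k where "k < 4" "c (n + k) = -1" using assms unfolding balanced_def by blast
  then show "-1 \<in> {c n, c (n+1), c (n+2), c (n+3)}" using k4[of k] by auto
qed (use assms in \<open>auto simp: balanced_def\<close>)

text \<open>Two opposite signs right after a sign have weight at least 2, which only the two last terms can
outweigh; this needs \<open>a3 \<ge> a1 + a2 > a2\<close>, so that
\<open>a3 \<le> a1 + 1\<close> must hold and pins down the weights as well.\<close>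

lemma balanced_forced:
  assumes "balanced a1 a2 a3 c" and "c n = 1" "c (n+1) = -1" "c (n+2) = -1"
  shows "a2 = 1 \<and> a3 = a1 + 1 \<and> c (n+3) = 1 \<and> c (n+4) = 1"
  using balancedD(4)[OF assms(1), of n] balancedD(1)[OF assms(1), of "n+3"]
    balancedD(1)[OF assms(1), of "n+4"] assms(2-4) a1 a2 a3 no_3_cycle
  by auto

text \<open>The forced continuation contains the same pattern with the signs reversed, two places later. This
forces the two terms after it, and they contradict the inequality in between.\<close>

lemma balanced_no_double:
  assumes c: "balanced a1 a2 a3 c" and n: "c n = 1" "c (n+1) = -1" "c (n+2) = -1"
  shows False
proof -
  have 1: "a2 = 1" "a3 = a1 + 1" "c (n+3) = 1" "c (n+4) = 1"
    using balanced_forced[OF c n] by simp_all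
  have "c (n+5) = -1" "c (n+6) = -1"
    using balanced_forced[OF balanced_uminus[OF c], of "n+2"] n 1 by (simp_all add: numeral_eq_Suc)
  then show False
    using balancedD(4)[OF c, of "n+3"] balancedD(1)[OF c, of "n+7"] 1 a1 by (auto simp: numeral_eq_Suc)
qed

text \<open>The inequalities at the two signs force the word \<open>1, -1, 0, 1, -1, -1\<close>, which ends in the
pattern excluded before.\<close>

lemma balanced_no_gap:
  assumes c: "balanced a1 a2 a3 c" and n: "c n = 1" "c (n+1) = -1" "c (n+2) = 0"
  shows False
proof -
  have 3: "c (n+3) = 1"
    using balancedD(4)[OF c, of n] balancedD(1)[OF c, of "n+3"] balancedD(1)[OF c, of "n+4"] n a1 a3 by auto
  have 4: "c (n+4) = -1"
    using balancedD(5)[OF c, of "n+1"] balancedD(1)[OF c, of "n+4"] balancedD(1)[OF c, of "n+5"] n 3 a2 a3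
    by (auto simp: numeral_eq_Suc)
  have "c (n+5) = -1"
    using balancedD(4)[OF c, of n] balancedD(5)[OF c, of "n+1"] balancedD(1)[OF c, of "n+5"] n 3 4 a1 no_3_cycle
    by (auto simp: numeral_eq_Suc)
  then show False
    using balanced_no_double[OF c, of "n+3"] 3 4 by (simp add: numeral_eq_Suc)
qed

text \<open>As the two patterns above are excluded, an immediate sign change is followed by a second one, and that
by a third. But the assumption \<open>a2 < a1 + a3\<close> excludes the alternation \<open>1, -1, 1, -1\<close>.\<close>

lemma balanced_no_jump:
  assumes c: "balanced a1 a2 a3 c" and n: "c n = 1" "c (n+1) = -1"
  shows False
proof -
  have 2: "c (n+2) = 1"
    using balanced_no_double[OF c n] balanced_no_gap[OF c n] balancedD(1)[OF c, of "n+2"] by auto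
  have "c (n+3) \<noteq> 1"
    using balanced_no_double[OF balanced_uminus[OF c], of "n+1"] n 2 by (auto simp: numeral_eq_Suc)
  moreover have "c (n+3) \<noteq> 0"
    using balanced_no_gap[OF balanced_uminus[OF c], of "n+1"] n 2 by (auto simp: numeral_eq_Suc)
  moreover have "c (n+3) \<noteq> -1"
    using balancedD(4)[OF c, of n] balancedD(1)[OF c, of "n+4"] n 2 no_alternation by auto
  ultimately show False using balancedD(1)[OF c, of "n+3"] by auto
qed

text \<open>If a sign were left through a 0, the opposite sign would have to appear within the window. Then, either
directly or by the inequality, some sign would be followed immediately by its opposite.\<close>

lemma balanced_constant:
  assumes c: "balanced a1 a2 a3 c" and n: "c n = 1"
  shows "c (n+1) = 1"
proof -
  have jump: "\<not> (c m = 1 \<and> c (m+1) = -1)" "\<not> (c m = -1 \<and> c (m+1) = 1)" for m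
    using balanced_no_jump[OF c] balanced_no_jump[OF balanced_uminus[OF c]] by fastforce+
  have "c (n+1) \<noteq> 0"
  proof
    assume 1: "c (n+1) = 0"
    have 2: "c (n+2) \<noteq> -1"
    proof
      assume 2: "c (n+2) = -1"
      then have "c (n+3) = 1"
        using balancedD(4)[OF c, of n] balancedD(1)[OF c, of "n+3"] balancedD(1)[OF c, of "n+4"] n 1 a2 a3 by auto
      then show False using jump(2)[of "n+2"] 2 by (simp add: numeral_eq_Suc)
    qed
    then have 3: "c (n+3) = -1"
      using balancedD(3)[OF c, of n] n 1 by auto
    then have "c (n+2) \<noteq> 1" "c (n+4) \<noteq> 1"
      using jump(1)[of "n+2"] jump(2)[of "n+3"] by (auto simp: numeral_eq_Suc)
    then show False
      using 2 3 balancedD(4)[OF c, of n] balancedD(1)[OF c, of "n+2"] balancedD(1)[OF c, of "n+4"] n 1 a3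
      by auto
  qed
  then show ?thesis
    using jump(1)[of n] n balancedD(1)[OF c, of "n+1"] by auto
qed

lemma not_balanced: "\<not> balanced a1 a2 a3 c"
proof
  assume c: "balanced a1 a2 a3 c"
  obtain n where n: "c n = 1" using c unfolding balanced_def by blast
  have "c (n+1) = 1" "c (n+2) = 1" "c (n+3) = 1"
    using balanced_constant[OF c, of n] balanced_constant[OF c, of "n+1"] balanced_constant[OF c, of "n+2"] n
    by (simp_all add: numeral_eq_Suc)
  then show False using balancedD(3)[OF c, of n] n by auto
qed

end

section \<open>Admissible integer sequences\<close>

text \<open>In terms of \<open>a n = u n - u (Suc n)\<close>, the quantity in absolute bars is
\<open>C a\<^sub>n + B a\<^sub>n\<^sub>+\<^sub>1 + A a\<^sub>n\<^sub>+\<^sub>2 + a\<^sub>n\<^sub>+\<^sub>3\<close>. Only the differences \<open>a\<close> are required to be bounded, which for integers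
is finiteness of their range.\<close>

definition admissible :: "int \<Rightarrow> int \<Rightarrow> int \<Rightarrow> (nat \<Rightarrow> int) \<Rightarrow> bool" where
  "admissible A B C u \<longleftrightarrow> finite (range (\<lambda>n. u n - u (Suc n))) \<and>
     (\<forall>n. \<bar>C * u n - ((C - B) * u (n+1) + (B - A) * u (n+2) + (A - 1) * u (n+3) + u (n+4))\<bar> < C)"

definition start :: "(nat \<Rightarrow> int) \<Rightarrow> int \<times> int \<times> int" where
  "start u = (u 0 - u 1, u 1 - u 2, u 2 - u 3)"

text \<open>The difference words of the nonconstant 0-1 words of length 4. A nonconstant 0-1 word can be recovered
from its differences, so there are 14.\<close>

definition binary_starts :: "(int \<times> int \<times> int) set" where
  "binary_starts = (\<lambda>(a, b, c, d). (a - b, b - c, c - d)) `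
     ({0, 1} \<times> {0, 1} \<times> {0, 1} \<times> {0, 1} - {(0, 0, 0, 0), (1, 1, 1, 1)})"

lemma binary_starts_eq:
  "binary_starts =
     {(0,0,-1), (0,-1,1), (0,-1,0), (-1,1,0), (-1,1,-1), (-1,0,1), (-1,0,0),
      (0,0,1), (0,1,-1), (0,1,0), (1,-1,0), (1,-1,1), (1,0,-1), (1,0,0)}"
  by (simp add: binary_starts_def insert_Times_insert insert_Diff_if insert_commute)

lemma binary_startsI:
  assumes "a \<in> {0, 1}" "b \<in> {0, 1}" "c \<in> {0, 1}" "d \<in> {0, 1}" and "\<not> (a = b \<and> b = c \<and> c = d)"
  shows "(a - b, b - c, c - d) \<in> binary_starts"
  unfolding binary_starts_eq using assms by (elim insertE emptyE) simp_all

lemma card_binary_starts: "card binary_starts = 14"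
  by (simp add: binary_starts_eq)

lemma weighted_sum_le:
  fixes p q r x1 x2 x3 x4 h :: int
  assumes "0 \<le> p" "0 \<le> q" "0 \<le> r" "x1 \<le> h" "x2 \<le> h" "x3 \<le> h" "x4 \<le> h"
  shows "p * x1 + q * x2 + r * x3 + x4 \<le> (p + q + r + 1) * h"
  using assms mult_left_mono[of x1 h p] mult_left_mono[of x2 h q] mult_left_mono[of x3 h r]
  by (simp add: algebra_simps)

context
  fixes A B C :: int
  assumes ABC: "1 \<le> A" "A \<le> B" "B < C"
begin

text \<open>The mean of the next four terms lies between their extremes, \<open>u n\<close> is less than 1 away from that
mean, and both \<open>u n\<close> and the extremes are integers.\<close>

lemma admissible_window_mono:
  assumes "admissible A B C u"
  shows "window_max u n \<le> window_max u (Suc n)" "window_min u (Suc n) \<le> window_min u n"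
proof -
  define h l where "h = window_max u (Suc n)" and "l = window_min u (Suc n)"
  have wb: "l \<le> u (n+1)" "l \<le> u (n+2)" "l \<le> u (n+3)" "l \<le> u (n+4)"
     "u (n+1) \<le> h" "u (n+2) \<le> h" "u (n+3) \<le> h" "u (n+4) \<le> h"
    using window_bounds4[of u "Suc n"] unfolding h_def l_def by (simp_all add: numeral_eq_Suc)
  define w where "w = (C - B) * u (n+1) + (B - A) * u (n+2) + (A - 1) * u (n+3) + u (n+4)"
  have u: "C * u n - w < C" "w - C * u n < C"
    using assms unfolding admissible_def w_def by (auto simp: abs_less_iff)
  have "w \<le> (C - B + (B - A) + (A - 1) + 1) * h"
    unfolding w_def using ABC wb by (intro weighted_sum_le) auto
  then have "C * u n < C * (h + 1)" using u by (simp add: algebra_simps)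
  then have "u n \<le> h" using ABC by simp
  moreover have "(C - B) * - u (n+1) + (B - A) * - u (n+2) + (A - 1) * - u (n+3) + - u (n+4)
      \<le> (C - B + (B - A) + (A - 1) + 1) * - l"
    using ABC wb by (intro weighted_sum_le) auto
  then have "C * l \<le> w" unfolding w_def by (simp add: algebra_simps)
  then have "C * (l - 1) < C * u n" using u by (simp add: algebra_simps)
  then have "l \<le> u n" using ABC by simp
  ultimately have "window_max u n \<le> h \<and> l \<le> window_min u n"
    using wb by (intro conjI window_extremes_le) auto
  then show "window_max u n \<le> window_max u (Suc n)" "window_min u (Suc n) \<le> window_min u n"
    unfolding h_def l_def by simp_all
qed

text \<open>Take \<open>N\<close> where the width is largest, which exists since widths are bounded. The ranges of the
windows increase with \<open>n\<close>, and from \<open>N\<close> on they can no longer grow.\<close>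

lemma admissible_stationary:
  assumes "admissible A B C u"
  obtains N where "\<And>n. N \<le> n \<Longrightarrow> window_max u n = window_max u N"
    "\<And>n. N \<le> n \<Longrightarrow> window_min u n = window_min u N"
    "\<And>n. window_max u n - window_min u n \<le> window_max u N - window_min u N"
proof -
  define width where "width n = nat (window_max u n - window_min u n)" for n
  have nonneg: "window_min u n \<le> window_max u n" for n
    using window_bounds4[of u n] by linarith
  define K where "K = Max (abs ` range (\<lambda>n. u n - u (Suc n)))"
  have "\<bar>u n - u (Suc n)\<bar> \<le> K" for n
    using assms unfolding admissible_def K_def by (intro Max_ge) auto
  then have "width n \<le> nat (3 * K)" for n
    unfolding width_def by (intro nat_mono window_width_le)
  then obtain N where N: "\<And>n. width n \<le> width N"
    using ex_has_greatest_nat[of "\<lambda>_. True" 0 width "nat (3 * K) + 1"] by (auto simp: less_Suc_eq_le)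
  have mono: "window_max u N \<le> window_max u n \<and> window_min u n \<le> window_min u N" if "N \<le> n" for n
    using that
  proof (induction rule: dec_induct)
    case (step n)
    then show ?case
      using admissible_window_mono[OF assms, of n] by linarith
  qed simp
  have le: "window_max u n - window_min u n \<le> window_max u N - window_min u N" for n
    using N[of n] nonneg[of n] nonneg[of N] unfolding width_def by linarith
  show thesis
  proof (rule that)
    show "window_max u n = window_max u N" "window_min u n = window_min u N" if "N \<le> n" for n
      using mono[OF that] le[of n] by linarith+
  qed (rule le)
qed

text \<open>At a maximum \<open>h\<close>, each of the next terms is at most \<open>h - 1\<close> plus its sign. This is where width at least 2
is needed: for the sign -1 it says that the minimum is at most \<open>h - 2\<close>. Averaging with weights of sum \<open>C\<close>
turns the inequality for \<open>u\<close> into the one for the signs. Minima are symmetric.\<close>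

lemma wide_admissible_imp_balanced:
  assumes u: "admissible A B C u"
    and h: "\<And>n. window_max u n = h" and l: "\<And>n. window_min u n = l" and wide: "l + 2 \<le> h"
  shows "balanced (C - B) (B - A) (A - 1) (\<lambda>n. if u n = h then 1 else if u n = l then -1 else 0)"
    (is "balanced _ _ _ ?c")
proof -
  have bounds: "l \<le> u n" "u n \<le> h" for n
    using window_bounds4[of u n] h l by auto
  have adm: "C * u n - ((C - B) * u (n+1) + (B - A) * u (n+2) + (A - 1) * u (n+3) + u (n+4)) < C"
      "((C - B) * u (n+1) + (B - A) * u (n+2) + (A - 1) * u (n+3) + u (n+4)) - C * u n < C" for n
    using u unfolding admissible_def by (auto simp: abs_less_iff)
  have near_h: "u n - ?c n - (h - 1) \<le> 0" for n
    using bounds[of n] wide by auto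
  have near_l: "l + 1 + ?c n - u n \<le> 0" for n
    using bounds[of n] wide by auto
  have "1 \<le> (C - B) * ?c (n+1) + (B - A) * ?c (n+2) + (A - 1) * ?c (n+3) + ?c (n+4)" if "?c n = 1" for n
  proof -
    have "u n = h" using that by (auto split: if_splits)
    moreover have "(C - B) * (u (n+1) - ?c (n+1) - (h - 1)) + (B - A) * (u (n+2) - ?c (n+2) - (h - 1))
       + (A - 1) * (u (n+3) - ?c (n+3) - (h - 1)) + (u (n+4) - ?c (n+4) - (h - 1)) \<le> (C - B + (B - A) + (A - 1) + 1) * 0"
      using ABC by (intro weighted_sum_le near_h) auto
    ultimately show ?thesis using adm(1)[of n] 
      by (simp add: algebra_simps del: if_split)
  qed
  moreover have "(C - B) * ?c (n+1) + (B - A) * ?c (n+2) + (A - 1) * ?c (n+3) + ?c (n+4) \<le> -1" if "?c n = -1" for n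
  proof -
    have "u n = l" using that by (auto split: if_splits)
    moreover have "(C - B) * (l + 1 + ?c (n+1) - u (n+1)) + (B - A) * (l + 1 + ?c (n+2) - u (n+2))
       + (A - 1) * (l + 1 + ?c (n+3) - u (n+3)) + (l + 1 + ?c (n+4) - u (n+4)) \<le> (C - B + (B - A) + (A - 1) + 1) * 0"
      using ABC by (intro weighted_sum_le near_l) auto
    ultimately show ?thesis using adm(2)[of n] 
      by (simp add: algebra_simps del: if_split)
  qed
  moreover have "\<exists>k<4. ?c (n + k) = 1" for n
    using window_extremes_attained(1)[of u n] h by auto
  moreover have "\<exists>k<4. ?c (n + k) = -1" for n
    using window_extremes_attained(2)[of u n] l wide by force
  ultimately show ?thesis unfolding balanced_def by auto
qed

lemma admissible_shift: "admissible A B C u \<Longrightarrow> admissible A B C (\<lambda>n. u (N + n))"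
  unfolding admissible_def
proof (intro conjI allI)
  fix n
  assume u: "finite (range (\<lambda>n. u n - u (Suc n))) \<and>
    (\<forall>n. \<bar>C * u n - ((C - B) * u (n + 1) + (B - A) * u (n + 2) + (A - 1) * u (n + 3) + u (n + 4))\<bar> < C)"
  then show "finite (range (\<lambda>n. u (N + n) - u (N + Suc n)))"
    by (auto elim!: finite_subset[rotated])
  show "\<bar>C * u (N + n) - ((C - B) * u (N + (n + 1)) + (B - A) * u (N + (n + 2)) + (A - 1) * u (N + (n + 3)) + u (N + (n + 4)))\<bar> < C"
    using u by (simp add: add.assoc[symmetric])
qed

text \<open>All windows have width at most 1, because the eventual window is the widest and a width of at least 2 would
produce a balanced sign sequence.\<close>

lemma admissible_start_binary:
  assumes "A < B" and "B - A < C - B + (A - 1)" and "A - 1 \<le> B - A \<or> A - 1 \<le> C - B + 1"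
    and u: "admissible A B C u"
  shows "start u \<in> insert (0, 0, 0) binary_starts"
proof -
  obtain N where N: "\<And>n. N \<le> n \<Longrightarrow> window_max u n = window_max u N"
    "\<And>n. N \<le> n \<Longrightarrow> window_min u n = window_min u N"
    "\<And>n. window_max u n - window_min u n \<le> window_max u N - window_min u N"
    using admissible_stationary[OF u] by blast
  have shift: "window_max (\<lambda>n. u (N + n)) n = window_max u (N + n)"
       "window_min (\<lambda>n. u (N + n)) n = window_min u (N + n)" for n
    by (simp_all add: window_max_def window_min_def add.assoc)
  have "window_max u N - window_min u N \<le> 1"
  proof (rule ccontr)
    assume wide: "\<not> window_max u N - window_min u N \<le> 1"
    have "window_min u N + 2 \<le> window_max u N" using wide by linarith
    moreover have "window_max (\<lambda>n. u (N + n)) n = window_max u N"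
        "window_min (\<lambda>n. u (N + n)) n = window_min u N" for n
      using N(1,2)[of "N + n"] by (simp_all only: shift le_add1)
    ultimately have "balanced (C - B) (B - A) (A - 1)
        (\<lambda>n. if u (N + n) = window_max u N then 1 else if u (N + n) = window_min u N then -1 else 0)"
      by (intro wide_admissible_imp_balanced admissible_shift[OF u])
    then show False
      using not_balanced[of "C - B" "B - A" "A - 1"] ABC assms(1-3) by simp
  qed
  then have le: "window_max u 0 - window_min u 0 \<le> 1" using N(3)[of 0] by linarith
  define l where "l = window_min u 0"
  have bin: "u k - l \<in> {0, 1}" if "k < 4" for k
    using window_bounds[OF that, of u 0] le unfolding l_def by auto
  show ?thesis
  proof (cases "u 0 = u 1 \<and> u 1 = u 2 \<and> u 2 = u 3")
    case False
    have "start u = ((u 0 - l) - (u 1 - l), (u 1 - l) - (u 2 - l), (u 2 - l) - (u 3 - l))"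
      unfolding start_def by simp
    moreover have "\<dots> \<in> binary_starts"
      using bin False by (intro binary_startsI) simp_all
    ultimately show ?thesis by simp
  qed (simp add: start_def)
qed

lemma admissibleI_periodic:
  assumes per: "\<And>n. u (n + p) = u n" and "0 < p"
    and step: "\<And>n. n < p \<Longrightarrow>
      \<bar>C * u n - ((C - B) * u (n+1) + (B - A) * u (n+2) + (A - 1) * u (n+3) + u (n+4))\<bar> < C"
  shows "admissible A B C u"
proof -
  have per': "u (n + m * p) = u n" for n m
    by (induction m) (use per in \<open>simp_all add: add.assoc[symmetric] add.commute[of p]\<close>)
  have mod: "u (n mod p + k) = u (n + k)" for n k
    using per'[of "n mod p + k" "n div p"] by (simp add: ac_simps)
  have "u n - u (Suc n) \<in> (\<lambda>n. u n - u (Suc n)) ` {..<p}" for n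
    using mod[of n 0] mod[of n 1] \<open>0 < p\<close> by (intro image_eqI[of _ _ "n mod p"]) auto
  then have "range (\<lambda>n. u n - u (Suc n)) \<subseteq> (\<lambda>n. u n - u (Suc n)) ` {..<p}"
    by blast
  then have "finite (range (\<lambda>n. u n - u (Suc n)))"
    by (rule finite_subset) simp
  moreover have "\<bar>C * u n - ((C - B) * u (n+1) + (B - A) * u (n+2) + (A - 1) * u (n+3) + u (n+4))\<bar> < C" for n
    using step[of "n mod p"] \<open>0 < p\<close> unfolding mod mod[of n 0, unfolded add_0_right] by simp
  ultimately show ?thesis unfolding admissible_def by blast
qed

text \<open>Continue the word with period 4. Then \<open>u (n + 4) = u n\<close>, which has weight 1 in the mean; hence the mean
is at least \<open>1 / C\<close> if \<open>u n = 1\<close> and at most \<open>1 - 1 / C\<close> if \<open>u n = 0\<close>, as required.\<close>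

lemma binary_starts_admissible:
  assumes "t \<in> binary_starts"
  obtains u where "admissible A B C u" "start u = t"
proof -
  obtain a b c d where t: "t = (a - b, b - c, c - d)"
    and abcd: "a \<in> {0, 1}" "b \<in> {0, 1}" "c \<in> {0, 1}" "d \<in> {0, 1}"
    using assms unfolding binary_starts_def by (elim imageE DiffE SigmaE) simp
  define u where "u n = (if n mod 4 = 0 then a else if n mod 4 = 1 then b else if n mod 4 = 2 then c else d)" for n :: nat
  have bin: "0 \<le> u n" "u n \<le> 1" for n using abcd unfolding u_def by auto
  have per: "u (n + 4) = u n" for n by (simp add: u_def)
  have "admissible A B C u"
  proof (rule admissibleI_periodic)
    fix n
    define w where "w = (C - B) * u (n+1) + (B - A) * u (n+2) + (A - 1) * u (n+3)"
    have "0 \<le> w" unfolding w_def using ABC bin by simp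
    moreover have "w \<le> (C - B) * 1 + (B - A) * 1 + (A - 1) * 1"
      unfolding w_def using ABC bin by (intro add_mono mult_left_mono) auto
    then have "w \<le> C - 1" by simp
    moreover have "u n = 0 \<or> u n = 1" using bin[of n] by auto
    ultimately have "\<bar>C * u n - (w + u n)\<bar> < C" using ABC by auto
    then show "\<bar>C * u n - ((C - B) * u (n+1) + (B - A) * u (n+2) + (A - 1) * u (n+3) + u (n+4))\<bar> < C"
      unfolding per w_def .
  qed (use per in auto)
  moreover have "start u = t" unfolding start_def u_def t by simp
  ultimately show thesis by (rule that)
qed

text \<open>The three alternatives are exactly what is needed for the periodic sequences \<open>0,1,2,1\<close> and \<open>0,2\<close> and
\<open>0,1,2\<close>, respectively.\<close>

lemma nonbinary_admissible:
  assumes "A = B \<or> C - B + (A - 1) \<le> B - A \<or> (B - A < A - 1 \<and> C - B + 2 \<le> A - 1)"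
  obtains u where "admissible A B C u" "start u \<notin> insert (0, 0, 0) binary_starts"
proof -
  have less4: "n = 0 \<or> n = 1 \<or> n = 2 \<or> n = 3" if "n < 4" for n :: nat using that by auto
  from assms consider "A = B" | "C - B + (A - 1) \<le> B - A" | "B - A < A - 1" "C - B + 2 \<le> A - 1" by blast
  then show thesis
  proof cases
    case 1
    define u :: "nat \<Rightarrow> int" where "u n = (if n mod 4 = 0 then 0 else if n mod 4 = 2 then 2 else 1)" for n
    have "admissible A B C u"
    proof (rule admissibleI_periodic[where p = 4])
      fix n :: nat assume "n < 4"
      then show "\<bar>C * u n - ((C - B) * u (n+1) + (B - A) * u (n+2) + (A - 1) * u (n+3) + u (n+4))\<bar> < C"
        using less4[of n] ABC 1 unfolding u_def by auto
    qed (auto simp: u_def)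
    moreover have "start u = (-1, -1, 1)" by (simp add: start_def u_def)
    ultimately show thesis using that by (simp add: binary_starts_eq)
  next
    case 2
    define u :: "nat \<Rightarrow> int" where "u n = (if n mod 2 = 0 then 0 else 2)" for n
    have "admissible A B C u"
    proof (rule admissibleI_periodic[where p = 2])
      fix n :: nat assume "n < 2"
      then show "\<bar>C * u n - ((C - B) * u (n+1) + (B - A) * u (n+2) + (A - 1) * u (n+3) + u (n+4))\<bar> < C"
        using less4[of n] ABC 2 unfolding u_def by (auto simp: numeral_eq_Suc mod_Suc)
    qed (auto simp: u_def)
    moreover have "start u = (-2, 2, -2)" by (simp add: start_def u_def)
    ultimately show thesis using that by (simp add: binary_starts_eq)
  next
    case 3
    define u :: "nat \<Rightarrow> int" where "u n = int (n mod 3)" for n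
    have "admissible A B C u"
    proof (rule admissibleI_periodic[where p = 3])
      fix n :: nat assume "n < 3"
      then show "\<bar>C * u n - ((C - B) * u (n+1) + (B - A) * u (n+2) + (A - 1) * u (n+3) + u (n+4))\<bar> < C"
        using less4[of n] ABC 3 unfolding u_def by auto
    qed (auto simp: u_def)
    moreover have "start u = (-1, -1, 2)" by (simp add: start_def u_def)
    ultimately show thesis using that by (simp add: binary_starts_eq)
  qed
qed

theorem card_admissible_starts_eq_14_iff:
  fixes E
  defines "E \<equiv> start ` {u. admissible A B C u} - {(0, 0, 0)}"
  shows "finite E \<and> card E = 14 \<longleftrightarrow>
    A < B \<and> B - A < C - B + (A - 1) \<and> (A - 1 \<le> B - A \<or> A - 1 \<le> C - B + 1)" (is "_ \<longleftrightarrow> ?good")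
proof -
  have sub: "binary_starts \<subseteq> E"
  proof
    fix t assume t: "t \<in> binary_starts"
    then obtain u where "admissible A B C u" "start u = t"
      by (rule binary_starts_admissible)
    moreover have "t \<noteq> (0, 0, 0)"
      using t by (auto simp: binary_starts_eq)
    ultimately show "t \<in> E" unfolding E_def by blast
  qed
  show ?thesis
  proof
    assume ?good
    then have "E \<subseteq> binary_starts"
      using admissible_start_binary unfolding E_def by blast
    then have "E = binary_starts" using sub by blast
    then show "finite E \<and> card E = 14"
      using card_binary_starts by (metis card.infinite zero_neq_numeral)
  next
    assume E: "finite E \<and> card E = 14"
    have "E = binary_starts"
      using E card_subset_eq[of E binary_starts] sub card_binary_starts by simp
    show ?good
    proof (rule ccontr)
      assume "\<not> ?good"
      then have "A = B \<or> C - B + (A - 1) \<le> B - A \<or> (B - A < A - 1 \<and> C - B + 2 \<le> A - 1)"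
        using ABC by linarith
      then obtain u where "admissible A B C u" "start u \<notin> insert (0, 0, 0) binary_starts"
        by (rule nonbinary_admissible)
      then show False
        using \<open>E = binary_starts\<close> unfolding E_def by blast
    qed
  qed
qed

end

section \<open>Integer points and group closures\<close>

lemma real_vec_simps [simp]:
  "real_vec 0 = 0" "real_vec (x + y) = real_vec x + real_vec y" "real_vec (x - y) = real_vec x - real_vec y"
  "real_vec (k *s x) = real_of_int k *\<^sub>R real_vec x" "real_vec x = real_vec y \<longleftrightarrow> x = y"
  by (auto simp: real_vec_def vec_eq_iff)

lemma real_vec_mult: "real_vec (M *v x) = real_mat M *v real_vec x"
  by (simp add: real_vec_def real_mat_def vec_eq_iff matrix_vector_mult_def map_matrix_def)

lemma matrix_vector_mult_smult:
  fixes M :: "'a::comm_ring_1 ^ 'n ^ 'm"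
  shows "M *v (k *s x) = k *s (M *v x)"
  by (simp add: vec_eq_iff matrix_vector_mult_def sum_distrib_left mult.left_commute)

lemma finite_bounded_int_vec:
  "finite {x :: int ^ 3. norm (real_vec x) \<le> K}"
proof -
  define k where "k = \<lfloor>K\<rfloor>"
  have "vec_nth x i \<in> {-k..k}" if "norm (real_vec x) \<le> K" for x :: "int ^ 3" and i
  proof -
    have "\<bar>real_of_int (vec_nth x i)\<bar> \<le> K"
      using component_le_norm_cart[of "real_vec x" i] that by (simp add: real_vec_def)
    then have "\<bar>vec_nth x i\<bar> \<le> k" unfolding k_def by (simp add: le_floor_iff)
    then show ?thesis by auto
  qed
  then have "(\<lambda>x. (vec_nth x 1, vec_nth x 2, vec_nth x 3)) ` {x :: int ^ 3. norm (real_vec x) \<le> K}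
      \<subseteq> {-k..k} \<times> {-k..k} \<times> {-k..k}"
    by auto
  then have "finite ((\<lambda>x. (vec_nth x 1, vec_nth x 2, vec_nth x 3)) ` {x :: int ^ 3. norm (real_vec x) \<le> K})"
    by (rule finite_subset) auto
  then show ?thesis
    by (rule finite_imageD) (auto simp: inj_on_def vec_eq_iff forall_3)
qed

lemma group_closure_scale:
  fixes x :: "int ^ 'n"
  assumes "x \<in> group_closure S"
  shows "k *s x \<in> group_closure S"
proof -
  have nat: "int n *s x \<in> group_closure S" for n
    by (induction n) (use assms in \<open>auto simp: vector_sadd_rdistrib intro: group_closure_add\<close>)
  have "- (int n *s x) \<in> group_closure S" for n
    using nat by simp
  then have "(- int n) *s x \<in> group_closure S" for n
    by (simp add: vector_smult_lneg)
  then show ?thesis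
    using nat by (cases k rule: int_cases2) auto
qed

text \<open>Given its digits, the forward orbit depends continuously on its first point, so the points whose first
terms stay in a compact set form a compact set.\<close>

primrec digit_orbit :: "real ^ 3 ^ 3 \<Rightarrow> real ^ 3 \<Rightarrow> (nat \<Rightarrow> int) \<Rightarrow> real ^ 3 \<Rightarrow> nat \<Rightarrow> real ^ 3" where
  "digit_orbit N w d x 0 = x"
| "digit_orbit N w d x (Suc n) = N *v digit_orbit N w d x n - real_of_int (d n) *\<^sub>R w"

lemma digit_orbit_shift:
  "digit_orbit N w d x (Suc n) = digit_orbit N w (\<lambda>n. d (Suc n)) (digit_orbit N w d x 1) n"
  by (induction n) auto

lemma continuous_on_digit_orbit: "continuous_on S (\<lambda>x. digit_orbit N w d x n)"
  by (induction n) (auto intro!: continuous_intros bounded_linear.continuous_on[OF matrix_vector_mul_bounded_linear])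

section \<open>Orbits in the tile\<close>

locale collinear_tile =
  fixes M :: "int ^ 3 ^ 3" and A B C :: int and v :: "int ^ 3" and T :: "(real ^ 3) set"
  assumes charpoly: "charpoly M = [:C, B, A, 1:]"
    and ABC: "1 \<le> A" "A \<le> B" "B < C"
    and self_affine: "self_affine_set M (collinear_digits C v) T"
    and positive_measure: "emeasure lebesgue T > 0"
begin

abbreviation "N \<equiv> real_mat M"
abbreviation "w \<equiv> real_vec v"
abbreviation "digit_seq d \<equiv> \<forall>n::nat. d n \<in> {0..C - 1}"

lemma compact_T: "compact T" and T_nonempty: "T \<noteq> {}"
  using self_affine unfolding self_affine_set_def by auto

lemma digit_eq: "{x + real_vec d |x d. x \<in> T \<and> d \<in> collinear_digits C v} = {x + real_of_int k *\<^sub>R w |x k. x \<in> T \<and> k \<in> {0..C - 1}}"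
  unfolding collinear_digits_def by force

lemma image_T: "(\<lambda>x. N *v x) ` T = {x + real_of_int k *\<^sub>R w |x k. x \<in> T \<and> k \<in> {0..C - 1}}"
  using self_affine unfolding self_affine_set_def digit_eq by blast

lemma cayley_hamilton_real:
  "N *v (N *v (N *v x)) = - (A *\<^sub>R (N *v (N *v x)) + B *\<^sub>R (N *v x) + C *\<^sub>R x)"
  using cayley_hamilton_3[OF charpoly_real_mat[OF charpoly], of x]
  unfolding scalar_mult_eq_scaleR by (simp only: eq_neg_iff_add_eq_0 add.assoc)

lemma cayley_hamilton_int:
  "M *v (M *v (M *v x)) = - (A *s (M *v (M *v x)) + B *s (M *v x) + C *s x)"
  using cayley_hamilton_3[OF charpoly, of x] by (simp only: eq_neg_iff_add_eq_0 add.assoc)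

lemma recurrence_eq_0:
  fixes s :: "nat \<Rightarrow> real"
  assumes "\<And>n. \<bar>s n\<bar> \<le> K" "\<And>n. s (n+3) + A * s (n+2) + B * s (n+1) + C * s n = 0"
  shows "s n = 0"
  using bounded_recurrence_eq_0[of A B C s K n] ABC assms by simp

lemma bounded_orbit_eq_0:
  assumes orbit: "\<And>n. y (Suc n) = N *v y n" and bounded: "\<And>n. norm (y n) \<le> K"
  shows "y 0 = 0"
proof -
  have "vec_nth (y 0) i = 0" for i
  proof (rule recurrence_eq_0)
    show "\<bar>vec_nth (y n) i\<bar> \<le> K" for n
      using component_le_norm_cart[of "y n" i] bounded[of n] by simp
    have y: "y (n+3) + A *\<^sub>R y (n+2) + B *\<^sub>R y (n+1) + C *\<^sub>R y n = 0" for n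
      using cayley_hamilton_real[of "y n"] by (simp add: orbit numeral_eq_Suc)
    show "vec_nth (y (n+3)) i + A * vec_nth (y (n+2)) i + B * vec_nth (y (n+1)) i + C * vec_nth (y n) i = 0" for n
      using arg_cong[OF y[of n], of "\<lambda>z. vec_nth z i"] by simp
  qed
  then show ?thesis by (simp add: vec_eq_iff)
qed

lemma orbit_of_point:
  assumes "x \<in> T"
  obtains y d where "y 0 = x" "digit_seq d"
    "\<And>n. y n \<in> T" "\<And>n. y (Suc n) = N *v y n - real_of_int (d n) *\<^sub>R w"
proof -
  have "\<exists>k\<in>{0..C - 1}. N *v x - real_of_int k *\<^sub>R w \<in> T" if "x \<in> T" for x
  proof -
    have "N *v x \<in> {x + real_of_int k *\<^sub>R w |x k. x \<in> T \<and> k \<in> {0..C - 1}}"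
      unfolding image_T[symmetric] using that by blast
    then obtain x' k where "N *v x = x' + real_of_int k *\<^sub>R w" "x' \<in> T" "k \<in> {0..C - 1}" by blast
    then show ?thesis by (intro bexI[of _ k]) auto
  qed
  then obtain k where k: "\<And>x. x \<in> T \<Longrightarrow> k x \<in> {0..C - 1}"
     "\<And>x. x \<in> T \<Longrightarrow> N *v x - real_of_int (k x) *\<^sub>R w \<in> T" by metis
  define y where "y n = ((\<lambda>x. N *v x - real_of_int (k x) *\<^sub>R w) ^^ n) x" for n
  have y: "y n \<in> T" for n
    by (induction n) (use assms k in \<open>auto simp: y_def\<close>)
  show thesis
  proof (rule that)
    show "y 0 = x" "y (Suc n) = N *v y n - real_of_int (k (y n)) *\<^sub>R w" for n by (simp_all add: y_def)
  qed (use y k in auto)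
qed

lemma finite_orbit_with_digits:
  assumes "digit_seq d"
  shows "\<exists>x. \<forall>n\<le>m. digit_orbit N w d x n \<in> T"
  using assms
proof (induction m arbitrary: d)
  case 0
  then show ?case using T_nonempty by auto
next
  case (Suc m)
  from Suc.prems have "digit_seq (\<lambda>n. d (Suc n))" by blast
  from Suc.IH[OF this] obtain x where x: "\<And>n. n \<le> m \<Longrightarrow> digit_orbit N w (\<lambda>n. d (Suc n)) x n \<in> T" by blast
  have "x \<in> T" using x[of 0] by simp
  then have "x + real_of_int (d 0) *\<^sub>R w \<in> (\<lambda>x. N *v x) ` T"
    unfolding image_T using Suc.prems by blast
  then obtain y where y: "y \<in> T" "x + real_of_int (d 0) *\<^sub>R w = N *v y" by blast
  then have 1: "digit_orbit N w d y 1 = x" by (simp flip: y(2))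
  have "digit_orbit N w d y n \<in> T" if "n \<le> Suc m" for n
  proof (cases n)
    case (Suc n')
    then show ?thesis using x[of n'] that unfolding digit_orbit_shift[of N w d y n'] Suc 1 by simp
  qed (use y in simp)
  then show ?case by blast
qed

text \<open>Finitely many digits are realised by going backwards from any point of \<open>T\<close>. The sets of points that
realise longer and longer initial segments are nested compact sets.\<close>

lemma orbit_with_digits:
  assumes d: "digit_seq d"
  obtains y where "\<And>n. y n \<in> T" "\<And>n. y (Suc n) = N *v y n - real_of_int (d n) *\<^sub>R w"
proof -
  define X where "X m = (\<Inter>n\<le>m. {x \<in> T. digit_orbit N w d x n \<in> T})" for m
  have closed: "closed {x \<in> T. digit_orbit N w d x n \<in> T}" for n
    using continuous_closed_preimage[OF continuous_on_digit_orbit compact_imp_closed[OF compact_T] compact_imp_closed[OF compact_T]]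
    by (simp add: vimage_def Int_def)
  have "compact (X m)" for m
  proof -
    have "X m = T \<inter> X m" unfolding X_def by auto
    moreover have "closed (X m)" unfolding X_def by (intro closed_INT ballI closed)
    ultimately show ?thesis using compact_T by (metis compact_Int_closed)
  qed
  moreover have "X m \<noteq> {}" for m
  proof -
    obtain x where x: "\<forall>n\<le>m. digit_orbit N w d x n \<in> T" using finite_orbit_with_digits[OF d] by blast
    then have "x \<in> T" using digit_orbit.simps(1) by (metis le0)
    then have "x \<in> X m" using x unfolding X_def by auto
    then show ?thesis by blast
  qed
  moreover have "X n \<subseteq> X m" if "m \<le> n" for m n
    unfolding X_def using that by (intro INT_anti_mono) auto
  ultimately have "\<Inter>(range X) \<noteq> {}" by (intro compact_nest) auto
  then obtain x where "\<And>m. x \<in> X m" by blast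
  then have "digit_orbit N w d x n \<in> T" for n unfolding X_def by blast
  then show thesis by (intro that[of "digit_orbit N w d x"]) auto
qed

text \<open>By Cayley-Hamilton such a \<open>\<phi>\<close> annihilates all \<open>M\<^sup>k v\<close>, so the digits drop out of the inner product of
\<open>\<phi>\<close> with an orbit, which is then a bounded solution of the linear recurrence.\<close>

lemma orthogonal_to_tile:
  fixes \<phi> :: "real ^ 3"
  assumes \<phi>: "\<phi> \<bullet> w = 0" "\<phi> \<bullet> (N *v w) = 0" "\<phi> \<bullet> (N *v (N *v w)) = 0" and x: "x \<in> T"
  shows "\<phi> \<bullet> x = 0"
proof -
  obtain y d where y: "y 0 = x" "\<And>n. y n \<in> T" "\<And>n. y (Suc n) = N *v y n - real_of_int (d n) *\<^sub>R w"
    using orbit_of_point[OF x] by metis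
  obtain K where K: "\<And>x. x \<in> T \<Longrightarrow> norm x \<le> K"
    using compact_imp_bounded[OF compact_T] unfolding bounded_iff by blast
  note linear = matrix_vector_mult_diff_distrib matrix_vector_mult_scaleR inner_diff_right \<phi>
  have "\<phi> \<bullet> y 0 = 0"
  proof (rule recurrence_eq_0)
    show "\<bar>\<phi> \<bullet> y n\<bar> \<le> norm \<phi> * K" for n
      using Cauchy_Schwarz_ineq2[of \<phi> "y n"] mult_left_mono[OF K[OF y(2)], of "norm \<phi>" n] by simp
    fix n
    have "\<phi> \<bullet> y (n+1) = \<phi> \<bullet> (N *v y n)" by (simp add: y(3) linear)
    moreover have "\<phi> \<bullet> y (n+2) = \<phi> \<bullet> (N *v (N *v y n))" by (simp add: y(3) linear numeral_eq_Suc)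
    moreover have "\<phi> \<bullet> y (n+3) = \<phi> \<bullet> (N *v (N *v (N *v y n)))"
      by (simp add: y(3) linear numeral_eq_Suc)
    ultimately show "\<phi> \<bullet> y (n+3) + A * (\<phi> \<bullet> y (n+2)) + B * (\<phi> \<bullet> y (n+1)) + C * (\<phi> \<bullet> y n) = 0"
      by (simp add: cayley_hamilton_real inner_add_right inner_diff_right)
  qed
  then show ?thesis using y(1) by simp
qed

text \<open>A linear dependence would provide a nonzero vector orthogonal to \<open>v\<close>, \<open>M v\<close>, \<open>M\<^sup>2 v\<close>, hence to \<open>T\<close>, and
put \<open>T\<close> into a plane of measure zero.\<close>

lemma cyclic_vector:
  assumes "p *\<^sub>R w + q *\<^sub>R (N *v w) + r *\<^sub>R (N *v (N *v w)) = 0"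
  shows "p = 0 \<and> q = 0 \<and> r = 0"
proof (rule ccontr)
  assume nz: "\<not> (p = 0 \<and> q = 0 \<and> r = 0)"
  have singular: "det Y = 0 \<longleftrightarrow> (\<exists>x. x \<noteq> 0 \<and> Y *v x = 0)" for Y :: "real ^ 3 ^ 3"
    using invertible_det_nz[of Y] by (auto simp: invertible_left_inverse matrix_left_invertible_ker)
  \<comment> \<open>The rows of \<open>X\<close> are dependent, so \<open>X\<close> has a nontrivial kernel.\<close>
  define X :: "real ^ 3 ^ 3" where "X = vector [w, N *v w, N *v (N *v w)]"
  have "transpose X *v vector [p, q, r] = 0"
    using assms by (simp add: X_def vec_eq_iff forall_3 matrix_vector_mult_def sum_3 transpose_def mult.commute)
  moreover have "(vector [p, q, r] :: real ^ 3) \<noteq> 0"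
    using nz by (auto simp: vec_eq_iff forall_3)
  ultimately have "det (transpose X) = 0" unfolding singular by blast
  then have "det X = 0" by simp
  then obtain \<phi> where \<phi>: "\<phi> \<noteq> 0" "X *v \<phi> = 0" unfolding singular by blast
  have "vec_nth X i \<bullet> \<phi> = 0" for i
    using arg_cong[OF \<phi>(2), of "\<lambda>z. vec_nth z i"] by (simp add: matrix_vector_mul_component)
  from this[of 1] this[of 2] this[of 3]
  have "\<phi> \<bullet> w = 0" "\<phi> \<bullet> (N *v w) = 0" "\<phi> \<bullet> (N *v (N *v w)) = 0"
    by (simp_all add: X_def inner_commute)
  then have "T \<subseteq> {x. \<phi> \<bullet> x = 0}" using orthogonal_to_tile by blast
  then have "negligible T" using negligible_hyperplane[of \<phi> 0] \<phi>(1) negligible_subset by blast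
  then have "emeasure lebesgue T = 0" by (simp add: negligible_iff_null_sets null_setsD1)
  then show False using positive_measure by simp
qed

section \<open>Neighbors as starts of admissible sequences\<close>

text \<open>The lattice point with coordinates \<open>x0, x1, x2\<close> in the basis \<open>M\<^sup>2 v + A M v + B v\<close>, \<open>M v + A v\<close>, \<open>v\<close>. In this
basis \<open>M\<close> shifts the coordinates: the new last one is the next term of a linear recurrence.\<close>

definition point :: "int \<times> int \<times> int \<Rightarrow> int ^ 3" where
  "point = (\<lambda>(x0, x1, x2). x2 *s v + x1 *s (M *v v + A *s v) + x0 *s (M *v (M *v v) + A *s (M *v v) + B *s v))"

lemma point_step: "M *v point (x0, x1, x2) + b *s v = point (x1, x2, b - A * x2 - B * x1 - C * x0)"
proof -
  have "M *v point (x0, x1, x2) = x2 *s (M *v v) + x1 *s (M *v (M *v v) + A *s (M *v v))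
     + x0 *s (M *v (M *v (M *v v)) + A *s (M *v (M *v v)) + B *s (M *v v))"
    by (simp add: point_def matrix_vector_right_distrib matrix_vector_mult_smult)
  then show ?thesis
    unfolding cayley_hamilton_int by (simp add: point_def vec_eq_iff algebra_simps)
qed

lemma inj_point: "inj point"
proof (rule injI)
  fix s t assume eq: "point s = point t"
  obtain s0 s1 s2 where s: "s = (s0, s1, s2)" by (cases s)
  obtain t0 t1 t2 where t: "t = (t0, t1, t2)" by (cases t)
  define x0 x1 x2 where "x0 = s0 - t0" and "x1 = s1 - t1" and "x2 = s2 - t2"
  have "real_vec (point s - point t) = 0" using eq by simp
  also have "point s - point t = (x2 + A * x1 + B * x0) *s v + (x1 + A * x0) *s (M *v v) + x0 *s (M *v (M *v v))"
    by (simp add: s t x0_def x1_def x2_def point_def vec_eq_iff algebra_simps)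
  finally have "real_of_int (x2 + A * x1 + B * x0) *\<^sub>R w + real_of_int (x1 + A * x0) *\<^sub>R (N *v w)
     + real_of_int x0 *\<^sub>R (N *v (N *v w)) = 0"
    by (simp only: real_vec_simps real_vec_mult)
  from cyclic_vector[OF this] have "x0 = 0" "x1 = 0" "x2 = 0" by auto
  then show "s = t" by (simp add: s t x0_def x1_def x2_def)
qed

lemma point_0: "point (0, 0, 0) = 0"
  by (simp add: point_def)

lemma digit_lattice_eq: "digit_lattice M (collinear_digits C v) = range point"
proof -
  define D where "D = collinear_digits C v"
  define S where "S = D \<union> (\<lambda>d. M *v d) ` D \<union> (\<lambda>d. M *v (M *v d)) ` D"
  have sub: "S \<subseteq> range point"
  proof -
    have "k *s v = point (0, 0, k)" for k by (simp add: point_def)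
    moreover have "M *v (k *s v) = point (0, k, - A * k)" for k
      using point_step[of 0 0 k 0] by (simp add: point_def)
    moreover have "M *v (M *v (k *s v)) = point (k, - A * k, A * A * k - B * k)" for k
      using point_step[of 0 0 k 0] point_step[of 0 k "- A * k" 0] by (simp add: point_def algebra_simps)
    ultimately show ?thesis unfolding S_def D_def collinear_digits_def by auto
  qed
  have "x \<in> range point" if "x \<in> group_closure S" for x
    using that
  proof induction
    case (base s)
    then show ?case using sub point_0 by (metis insertE rangeI subsetD)
  next
    case (diff s t)
    then obtain s0 s1 s2 t0 t1 t2 where "s = point (s0, s1, s2)" "t = point (t0, t1, t2)" by auto
    then have "s - t = point (s0 - t0, s1 - t1, s2 - t2)"
      by (simp add: point_def vec_eq_iff algebra_simps)
    then show ?case by blast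
  qed
  moreover have "point t \<in> group_closure S" for t
  proof -
    have "v \<in> D" unfolding D_def collinear_digits_def using ABC by (intro image_eqI[of _ _ 1]) auto
    then have "v \<in> group_closure S" "M *v v \<in> group_closure S" "M *v (M *v v) \<in> group_closure S"
      unfolding S_def by (auto intro: group_closure.base)
    then show ?thesis
      unfolding point_def by (cases t) (simp add: group_closure_add group_closure_scale)
  qed
  ultimately show ?thesis unfolding digit_lattice_def S_def D_def by blast
qed

text \<open>The coordinates of the differences of two orbits form the sequence \<open>a\<close>; it has finite range because the
differences are lattice points in a bounded set.\<close>

lemma neighbor_imp_admissible:
  assumes "x \<in> T" "y \<in> T" "x = y + real_vec (point t)"
  shows "\<exists>u. admissible A B C u \<and> start u = t"
proof -
  obtain X d where X: "X 0 = x" "digit_seq d" "\<And>n. X n \<in> T"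
     "\<And>n. X (Suc n) = N *v X n - real_of_int (d n) *\<^sub>R w"
    using orbit_of_point[OF assms(1)] by metis
  obtain Y e where Y: "Y 0 = y" "digit_seq e" "\<And>n. Y n \<in> T"
     "\<And>n. Y (Suc n) = N *v Y n - real_of_int (e n) *\<^sub>R w"
    using orbit_of_point[OF assms(2)] by metis
  define st where "st = rec_nat t (\<lambda>n (x0, x1, x2). (x1, x2, (e n - d n) - A * x2 - B * x1 - C * x0))"
  define a where "a n = fst (st n)" for n
  have st_Suc: "st (Suc n) = (case st n of (x0, x1, x2) \<Rightarrow> (x1, x2, (e n - d n) - A * x2 - B * x1 - C * x0))" for n
    by (simp add: st_def)
  have st_eq: "st n = (a n, a (n+1), a (n+2))" for n
    by (simp add: a_def st_Suc split: prod.split)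
  have rec: "a (n+3) = (e n - d n) - A * a (n+2) - B * a (n+1) - C * a n" for n
    using st_Suc[of n] unfolding st_eq by (simp add: numeral_eq_Suc)
  have pt: "real_vec (point (st n)) = X n - Y n" for n
  proof (induction n)
    case 0
    then show ?case using assms(3) X(1) Y(1) by (simp add: st_def)
  next
    case (Suc n)
    have "point (st (Suc n)) = M *v point (st n) + (e n - d n) *s v"
      by (cases "st n") (simp only: st_Suc point_step prod.case)
    then have "real_vec (point (st (Suc n))) = N *v (X n - Y n) + real_of_int (e n - d n) *\<^sub>R w"
      by (simp only: real_vec_simps real_vec_mult Suc)
    then show ?case
      by (simp add: X(4) Y(4) algebra_simps)
  qed
  obtain K where K: "\<And>x. x \<in> T \<Longrightarrow> norm x \<le> K"
    using compact_imp_bounded[OF compact_T] unfolding bounded_iff by blast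
  have "norm (real_vec (point (st n))) \<le> 2 * K" for n
    using norm_triangle_ineq4[of "X n" "Y n"] K[OF X(3)[of n]] K[OF Y(3)[of n]] unfolding pt by simp
  then have "finite (range (\<lambda>n. point (st n)))"
    by (intro finite_subset[OF _ finite_bounded_int_vec[of "2 * K"]]) auto
  then have "finite (range st)"
    using inj_point by (metis finite_imageD inj_on_subset subset_UNIV range_composition comp_def)
  then have fin: "finite (range a)"
    unfolding a_def by (metis finite_imageI range_composition)
  define u where "u n = - (\<Sum>k<n. a k)" for n
  have a_eq: "a n = u n - u (Suc n)" for n by (simp add: u_def)
  have "admissible A B C u"
    unfolding admissible_def
  proof (intro conjI allI)
    show "finite (range (\<lambda>n. u n - u (Suc n)))" using fin unfolding a_eq .
    fix n
    have "C * u n - ((C - B) * u (n+1) + (B - A) * u (n+2) + (A - 1) * u (n+3) + u (n+4))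
       = C * a n + B * a (n+1) + A * a (n+2) + a (n+3)"
      unfolding a_eq by (simp add: algebra_simps numeral_eq_Suc)
    also have "\<dots> = e n - d n" by (simp add: rec)
    also have "\<bar>\<dots>\<bar> < C" using X(2) Y(2) by (auto simp: abs_less_iff dest!: spec[of _ n])
    finally show "\<bar>C * u n - ((C - B) * u (n+1) + (B - A) * u (n+2) + (A - 1) * u (n+3) + u (n+4))\<bar> < C" .
  qed
  moreover have "start u = t"
    using st_eq[of 0] unfolding start_def a_eq by (simp add: st_def numeral_eq_Suc)
  ultimately show ?thesis by blast
qed

text \<open>Take two orbits in \<open>T\<close> whose digits differ by the prescribed amounts. Their difference minus the walk
of lattice points is a bounded orbit of \<open>M\<close>, hence zero.\<close>

lemma admissible_imp_neighbor:
  assumes u: "admissible A B C u"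
  obtains x y where "x \<in> T" "y \<in> T" "x = y + real_vec (point (start u))"
proof -
  define a where "a n = u n - u (Suc n)" for n
  define b where "b n = C * a n + B * a (n+1) + A * a (n+2) + a (n+3)" for n
  have "b n = C * u n - ((C - B) * u (n+1) + (B - A) * u (n+2) + (A - 1) * u (n+3) + u (n+4))" for n
    unfolding a_def b_def by (simp add: algebra_simps numeral_eq_Suc)
  then have b: "\<bar>b n\<bar> < C" for n using u unfolding admissible_def by simp
  \<comment> \<open>Any integer of modulus less than \<open>C\<close> is a difference of two digits, one of which is 0.\<close>
  define d where "d n = max 0 (- b n)" for n
  define e where "e n = max 0 (b n)" for n
  have de: "digit_seq d" "digit_seq e" "e n - d n = b n" for n
    using b ABC unfolding d_def e_def by (auto simp: abs_less_iff max_def)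
  obtain X where X: "\<And>n. X n \<in> T" "\<And>n. X (Suc n) = N *v X n - real_of_int (d n) *\<^sub>R w"
    using orbit_with_digits[OF de(1)] by metis
  obtain Y where Y: "\<And>n. Y n \<in> T" "\<And>n. Y (Suc n) = N *v Y n - real_of_int (e n) *\<^sub>R w"
    using orbit_with_digits[OF de(2)] by metis
  define p where "p n = point (a n, a (n+1), a (n+2))" for n
  have p_Suc: "p (Suc n) = M *v p n + (e n - d n) *s v" for n
    unfolding p_def point_step de(3) b_def by (simp add: numeral_eq_Suc)
  have real_p_Suc: "real_vec (p (Suc n)) = N *v real_vec (p n) + real_of_int (e n - d n) *\<^sub>R w" for n
    by (simp only: p_Suc real_vec_simps real_vec_mult)
  obtain K where K: "\<And>x. x \<in> T \<Longrightarrow> norm x \<le> K"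
    using compact_imp_bounded[OF compact_T] unfolding bounded_iff by blast
  have "finite (range a)" using u unfolding admissible_def a_def by blast
  then have "finite (point ` (range a \<times> range a \<times> range a))" by blast
  then have "finite (range p)"
    by (rule finite_subset[rotated]) (auto simp: p_def)
  then have "bounded (range (\<lambda>n. real_vec (p n)))"
    by (intro finite_imp_bounded) (metis finite_imageI range_composition)
  then obtain L where L: "\<And>n. norm (real_vec (p n)) \<le> L" unfolding bounded_iff by auto
  have "X 0 - Y 0 - real_vec (p 0) = 0"
  proof (rule bounded_orbit_eq_0[where y = "\<lambda>n. X n - Y n - real_vec (p n)"])
    show "X (Suc n) - Y (Suc n) - real_vec (p (Suc n)) = N *v (X n - Y n - real_vec (p n))" for n
      by (simp add: X(2) Y(2) real_p_Suc algebra_simps)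
    show "norm (X n - Y n - real_vec (p n)) \<le> 2 * K + L" for n
      using norm_triangle_ineq4[of "X n - Y n" "real_vec (p n)"] norm_triangle_ineq4[of "X n" "Y n"]
        K[OF X(1)[of n]] K[OF Y(1)[of n]] L[of n] by simp
  qed
  moreover have "p 0 = point (start u)" unfolding p_def a_def start_def by (simp add: numeral_eq_Suc)
  ultimately show thesis using that[OF X(1)[of 0] Y(1)[of 0]] by (simp add: diff_eq_eq add.commute)
qed

lemma neighbors_eq:
  "neighbors M (collinear_digits C v) T = point ` (start ` {u. admissible A B C u} - {(0, 0, 0)})"
proof -
  have nz: "point t = 0 \<longleftrightarrow> t = (0, 0, 0)" for t
    using inj_point point_0 by (metis injD)
  have meet: "T \<inter> (\<lambda>x. x + real_vec (point t)) ` T \<noteq> {} \<longleftrightarrow> t \<in> start ` {u. admissible A B C u}" for t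
    using neighbor_imp_admissible[of _ _ t] admissible_imp_neighbor by blast
  have "{\<alpha> \<in> range point - {0}. P \<alpha>} = point ` ({t. P (point t)} - {(0, 0, 0)})" for P
    using nz by auto
  then show ?thesis
    unfolding neighbors_def digit_lattice_eq by (simp only: meet Collect_mem_eq)
qed

lemma card_neighbors_eq_14_iff:
  "finite (neighbors M (collinear_digits C v) T) \<and> card (neighbors M (collinear_digits C v) T) = 14 \<longleftrightarrow>
    A < B \<and> B - A < C - B + (A - 1) \<and> (A - 1 \<le> B - A \<or> A - 1 \<le> C - B + 1)"
proof -
  have inj: "inj_on point S" for S using inj_point by (rule inj_on_subset) simp
  show ?thesis
    unfolding neighbors_eq finite_image_iff[OF inj] card_image[OF inj]
    by (rule card_admissible_starts_eq_14_iff[OF ABC])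
qed

end

theorem theorem1p5:
  fixes M :: "int ^ 3 ^ 3" and A B C :: int and v :: "int ^ 3" and T :: "(real ^ 3) set"
  assumes "charpoly M = [:C, B, A, 1:]"
    and "1 \<le> A" and "A \<le> B" and "B < C"
    and "v \<noteq> 0"
    and "self_affine_set M (collinear_digits C v) T"
    and "emeasure lebesgue T > 0"
  shows "finite (neighbors M (collinear_digits C v) T) \<and>
           card (neighbors M (collinear_digits C v) T) = 14 \<longleftrightarrow>
         (1 \<le> A \<and> A < B \<and> B < C) \<and> B \<ge> 2 * A - 1 \<and> C \<ge> 2 * (B - A) + 2 \<or>
         (1 \<le> A \<and> A < B \<and> B < C) \<and> B < 2 * A - 1 \<and> C \<ge> A + B - 2"
proof -
  interpret collinear_tile M A B C v T
    using assms by unfold_locales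
  show ?thesis
    unfolding card_neighbors_eq_14_iff using ABC by auto
qed

end
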